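(* Let $n \ge 0$ be an integer and let $\mathbb{R}^n \times [0,\infty) \subset \mathbb{R}^{n+1}$ be the Euclidean half-space with the Euclidean metric, regarded as the open cone on the $n$-disk $D^n$. Then every coarse map $f: \mathbb{R}^n \times [0,\infty) \to \mathbb{R}^n \times [0,\infty)$ has the coarse fixed point property.
   Context: Coarse map. Let $X$ and $Y$ be metric spaces. A function $f: X \to Y$ (not assumed continuous) is a coarse map if (i) it is proper: $f^{-1}(B) \subset X$ is bounded for every bounded $B \subset Y$; and (ii) it is bornologous: for every $R > 0$ there exists $S > 0$ such that for all $x,x' \in X$ with $d_X(x,x') \le R$ one has $d_Y(f(x),f(x')) \le S$. Open cone. For a compact subset $X$ of the unit sphere of a real Hilbert space $E$, the open cone $\mathcal{O}X$ is identified with the subset $\{s\zeta : s \in [0,\infty),\ \zeta \in X\} \subset E$, with the metric induced from $E$. For $\zeta \in X$, the ray $\mathcal{O}\zeta$ is $\{s\zeta : s \ge 0\}$. The half-space $\mathbb{R}^n \times [0,\infty)$ with its Euclidean metric is the open cone $\mathcal{O}D^n$, where $D^n$ is realized as the closed unit hemisphere $\{\zeta \in \mathbb{R}^{n+1} : |\zeta| = 1,\ \zeta_{n+1} \ge 0\}$. Coarse fixed point property. A coarse map $f: \mathcal{O}X \to \mathcal{O}X$ has the coarse fixed point property if there exist a sequence of points $\zeta_i \in X$, a constant $R > 0$, and a sequence of points $x_i \to \infty$ in $\mathcal{O}X$ (i.e. $|x_i| \to \infty$) such that, for all $i$, both $x_i$ and $f(x_i)$ are within distance $R$ of the ray $\mathcal{O}\zeta_i$.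 *)

theory Defs
  imports "HOL-Analysis.Analysis"
begin

text \<open>Metric spaces are represented as subsets of a type of class \<^class>\<open>metric_space\<close>
  with the induced metric; maps between them are only looked at on their domain.\<close>

definition proper_map_on ::
    "'a::metric_space set \<Rightarrow> 'b::metric_space set \<Rightarrow> ('a \<Rightarrow> 'b) \<Rightarrow> bool" where
  "proper_map_on X Y f \<longleftrightarrow> (\<forall>B\<subseteq>Y. bounded B \<longrightarrow> bounded (f -` B \<inter> X))"

definition bornologous_on ::
    "'a::metric_space set \<Rightarrow> ('a \<Rightarrow> 'b::metric_space) \<Rightarrow> bool" where
  "bornologous_on X f \<longleftrightarrow>
     (\<forall>R>0. \<exists>S>0. \<forall>x\<in>X. \<forall>x'\<in>X. dist x x' \<le> R \<longrightarrow> dist (f x) (f x') \<le> S)"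

definition coarse_map ::
    "'a::metric_space set \<Rightarrow> 'b::metric_space set \<Rightarrow> ('a \<Rightarrow> 'b) \<Rightarrow> bool" where
  "coarse_map X Y f \<longleftrightarrow> f \<in> X \<rightarrow> Y \<and> proper_map_on X Y f \<and> bornologous_on X f"

definition open_cone :: "'a::real_inner set \<Rightarrow> 'a set" where
  "open_cone X = {s *\<^sub>R \<zeta> | s \<zeta>. 0 \<le> s \<and> \<zeta> \<in> X}"

definition ray :: "'a::real_inner \<Rightarrow> 'a set" where
  "ray \<zeta> = {s *\<^sub>R \<zeta> | s. 0 \<le> s}"

text \<open>Meant for compact \<open>X \<subseteq> sphere 0 1\<close> and coarse maps \<open>f\<close> from \<open>open_cone X\<close> to itself.\<close>

definition coarse_fixed_point_property :: "'a::real_inner set \<Rightarrow> ('a \<Rightarrow> 'a) \<Rightarrow> bool" where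
  "coarse_fixed_point_property X f \<longleftrightarrow>
     (\<exists>(\<zeta> :: nat \<Rightarrow> 'a) (R :: real) (x :: nat \<Rightarrow> 'a).
        (\<forall>i. \<zeta> i \<in> X) \<and> R > 0 \<and> (\<forall>i. x i \<in> open_cone X) \<and>
        filterlim (\<lambda>i. norm (x i)) at_top sequentially \<and>
        (\<forall>i. infdist (x i) (ray (\<zeta> i)) \<le> R \<and> infdist (f (x i)) (ray (\<zeta> i)) \<le> R))"

text \<open>The ambient space of dimension \<open>n + 1\<close> is \<open>real ^ 'm\<close> with \<open>CARD('m) = n + 1\<close>. An index
  \<open>k\<close> of \<open>'m\<close> plays the role of the last coordinate, the other \<open>n\<close> indices being the
  coordinates of \<open>n\<close>-space. (A product type \<open>(real ^ 'n) \<times> real\<close> would exclude \<open>n = 0\<close>, since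
  types are nonempty.)\<close>

definition half_space :: "'m::finite \<Rightarrow> (real ^ 'm) set" where
  "half_space k = {x. 0 \<le> x $ k}"

definition hemisphere :: "'m::finite \<Rightarrow> (real ^ 'm) set" where
  "hemisphere k = {\<zeta>. norm \<zeta> = 1 \<and> 0 \<le> \<zeta> $ k}"

lemma compact_hemisphere: "compact (hemisphere k)"
proof -
  have "hemisphere k = sphere 0 1 \<inter> {\<zeta>. \<zeta> $ k \<ge> 0}"
    by (auto simp: hemisphere_def)
  moreover have "closed {\<zeta> :: real ^ 'a. \<zeta> $ k \<ge> 0}"
    by (rule closed_halfspace_component_ge_cart)
  ultimately show ?thesis
    by (simp add: compact_Int_closed)
qed

lemma open_cone_hemisphere: "open_cone (hemisphere k) = half_space k"
proof (intro equalityI subsetI)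
  fix x assume "x \<in> open_cone (hemisphere k)"
  then show "x \<in> half_space k"
    by (auto simp: open_cone_def hemisphere_def half_space_def)
next
  fix x :: "real ^ 'a" assume x: "x \<in> half_space k"
  show "x \<in> open_cone (hemisphere k)"
  proof (cases "x = 0")
    case True
    have "axis k 1 \<in> hemisphere k"
      by (simp add: hemisphere_def axis_def[of k] norm_axis_1[unfolded axis_def])
    then have "0 *\<^sub>R axis k 1 \<in> open_cone (hemisphere k)"
      unfolding open_cone_def by blast
    then show ?thesis by (simp add: True)
  next
    case False
    have "x = norm x *\<^sub>R (x /\<^sub>R norm x)"
      using False by simp
    moreover have "x /\<^sub>R norm x \<in> hemisphere k"
      using False x by (simp add: hemisphere_def half_space_def)
    ultimately show ?thesis
      unfolding open_cone_def using norm_ge_zero by blast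
  qed
qed

end

theory Submission imports Defs begin

text \<open>On each large hemisphere of radius \<open>r\<close>, replace \<open>f\<close> by a continuous map \<open>g\<close> whose distance
  to \<open>f\<close> is bounded independently of \<open>r\<close>. Properness makes \<open>g\<close> nonvanishing there, so
  \<open>\<zeta> \<mapsto> g (r \<zeta>) / \<bar>g (r \<zeta>)\<bar>\<close> is a continuous self-map of the hemisphere, which is a disk. At a
  Brouwer fixed point \<open>\<zeta>\<close> both \<open>r \<zeta>\<close> and \<open>g (r \<zeta>)\<close> lie on the ray through \<open>\<zeta>\<close>.\<close>

text \<open>A partition of unity on a finite \<open>e\<close>-net \<open>T\<close> of
  \<open>K\<close> smooths \<open>f\<close>: \<open>g x\<close> averages the values
  \<open>f c\<close> over the net points \<open>c\<close> with \<open>dist c x < e\<close>. Each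
  such value lies in the convex set \<open>C \<inter> cball (f x) S\<close>, hence so does the
  average.\<close>

lemma continuous_approximation_on_compact:
  fixes f :: "'a::metric_space \<Rightarrow> 'b::real_normed_vector"
  assumes "compact K" "0 < e" "convex C" "f \<in> K \<rightarrow> C"
    and close: "\<And>x y. \<lbrakk>x \<in> K; y \<in> K; dist x y < e\<rbrakk> \<Longrightarrow> dist (f x) (f y) \<le> S"
  obtains g where "continuous_on K g" "g \<in> K \<rightarrow> C" "\<And>x. x \<in> K \<Longrightarrow> dist (f x) (g x) \<le> S"
proof -
  obtain T where T: "finite T" "T \<subseteq> K" "K \<subseteq> (\<Union>c\<in>T. ball c e)"
  proof (rule compactE_image[OF \<open>compact K\<close>])
    show "K \<subseteq> (\<Union>c\<in>K. ball c e)"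
      using \<open>0 < e\<close> by force
  qed auto
  \<comment> \<open>Tent functions: \<open>w c\<close> is continuous and positive exactly on
    \<open>ball c e\<close>, so the covering by these balls keeps the normalizing sum
    \<open>W\<close> positive on \<open>K\<close>.\<close>
  define w where "w c x = max 0 (e - dist c x)" for c x :: 'a
  define W where "W x = (\<Sum>c\<in>T. w c x)" for x
  define g where "g x = (\<Sum>c\<in>T. (w c x / W x) *\<^sub>R f c)" for x
  have w_nonneg: "0 \<le> w c x" for c x
    by (simp add: w_def)
  have W_pos: "0 < W x" if "x \<in> K" for x
  proof -
    obtain c where "c \<in> T" "dist c x < e"
      using subsetD[OF T(3) \<open>x \<in> K\<close>] by auto
    then show ?thesis
      unfolding W_def using T(1) w_nonneg by (intro sum_pos2[of T c]) (auto simp: w_def)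
  qed
  have cont: "continuous_on K g"
    unfolding g_def W_def
  proof (intro continuous_intros)
    show "\<forall>x\<in>K. (\<Sum>c\<in>T. w c x) \<noteq> 0"
      using W_pos by (force simp: W_def)
  qed (auto simp: w_def intro!: continuous_intros)
  have g_in: "g x \<in> C \<inter> cball (f x) S" if x: "x \<in> K" for x
  proof -
    \<comment> \<open>Only net points near \<open>x\<close> have values known to be close to
      \<open>f x\<close>. The others carry weight zero, so the sum is cut down to \<open>T'\<close>
      before convexity is applied.\<close>
    define T' where "T' = {c \<in> T. dist c x < e}"
    have zero: "w c x = 0" if "c \<in> T - T'" for c
      using that by (auto simp: w_def T'_def)
    have T': "finite T'" "T' \<subseteq> T"
      using T(1) by (auto simp: T'_def)
    have "W x = (\<Sum>c\<in>T'. w c x)"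
      unfolding W_def by (rule sum.mono_neutral_right) (use T T' zero in auto)
    then have one: "(\<Sum>c\<in>T'. w c x / W x) = 1"
      using W_pos[OF x] by (simp flip: sum_divide_distrib)
    have "g x = (\<Sum>c\<in>T'. (w c x / W x) *\<^sub>R f c)"
      unfolding g_def by (rule sum.mono_neutral_right) (use T T' zero in auto)
    also have "\<dots> \<in> C \<inter> cball (f x) S"
    proof (rule convex_sum)
      show "convex (C \<inter> cball (f x) S)"
        using \<open>convex C\<close> by (simp add: convex_Int)
      show "f c \<in> C \<inter> cball (f x) S" if "c \<in> T'" for c
        using that T(2) x \<open>f \<in> K \<rightarrow> C\<close> close[of x c] by (auto simp: T'_def dist_commute)
    qed (use T' one W_pos[OF x] w_nonneg in auto)
    finally show ?thesis .
  qed
  show thesis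
    using that[OF cont] g_in by auto
qed

text \<open>Orthogonal projection along \<open>axis k 1\<close> identifies the hemisphere with the
  flat unit disk \<open>D\<close>, with inverse \<open>lift\<close>, so Brouwer's theorem is applied
  to the conjugate of \<open>h\<close>. As \<open>D\<close> is compact, convex and nonempty, it can
  stay inside the hyperplane of \<open>real ^ 'm\<close>; this also covers dimension zero, where
  \<open>D\<close> is a point.\<close>

lemma brouwer_hemisphere:
  fixes k :: "'m::finite"
  assumes cont: "continuous_on (hemisphere k) h"
    and maps: "h \<in> hemisphere k \<rightarrow> hemisphere k"
  obtains \<zeta> where "\<zeta> \<in> hemisphere k" "h \<zeta> = \<zeta>"
proof -
  define D where "D = cball 0 1 \<inter> {x :: real ^ 'm. x $ k = 0}"
  define lift where "lift x = x + sqrt (1 - (norm x)\<^sup>2) *\<^sub>R axis k (1::real)" for x :: "real ^ 'm"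
  define proj where "proj x = x - (x $ k) *\<^sub>R axis k (1::real)" for x :: "real ^ 'm"
  have norm_lift: "(norm (x + a *\<^sub>R axis k 1))\<^sup>2 = (norm x)\<^sup>2 + a\<^sup>2"
    if "x $ k = 0" for x :: "real ^ 'm" and a
    using that norm_add_Pythagorean[of x "a *\<^sub>R axis k 1"]
    by (simp add: orthogonal_def inner_axis)
  have norm_proj: "(norm x)\<^sup>2 = (norm (proj x))\<^sup>2 + (x $ k)\<^sup>2" for x
    using norm_lift[of "proj x" "x $ k"] by (simp add: proj_def)
  have lift_in: "lift x \<in> hemisphere k" if "x \<in> D" for x
  proof -
    have x: "norm x \<le> 1" "x $ k = 0"
      using that by (auto simp: D_def)
    then have le: "(norm x)\<^sup>2 \<le> 1"
      by (simp add: power_le_one)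
    then have "(norm (lift x))\<^sup>2 = 1"
      using x by (simp add: lift_def norm_lift)
    then have "norm (lift x) = 1"
      by (metis norm_ge_zero power2_eq_1_iff not_one_le_zero neg_0_le_iff_le)
    then show ?thesis
      using x le by (simp add: hemisphere_def lift_def)
  qed
  have proj_in: "proj x \<in> D" if "x \<in> hemisphere k" for x
  proof -
    have "(norm (proj x))\<^sup>2 \<le> 1\<^sup>2"
      using norm_proj[of x] that by (simp add: hemisphere_def) (metis le_add_same_cancel1 zero_le_power2)
    then have "norm (proj x) \<le> 1"
      by (rule power2_le_imp_le) simp
    then show ?thesis
      by (simp add: D_def proj_def)
  qed
  have lift_proj: "lift (proj x) = x" if "x \<in> hemisphere k" for x
  proof -
    \<comment> \<open>The sign condition lets the square root in \<open>lift\<close> return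
      \<open>x $ k\<close> itself rather than its absolute value.\<close>
    have "1 - (norm (proj x))\<^sup>2 = (x $ k)\<^sup>2" "0 \<le> x $ k"
      using norm_proj[of x] that by (auto simp: hemisphere_def)
    then show ?thesis
      by (simp add: lift_def proj_def)
  qed
  obtain x where x: "x \<in> D" "proj (h (lift x)) = x"
  proof (rule brouwer[of D "proj \<circ> h \<circ> lift"])
    have "closed {x :: real ^ 'm. x $ k = 0}"
      by (intro closed_Collect_eq continuous_intros)
    then show "compact D"
      by (simp add: D_def compact_Int_closed)
    have "convex {x :: real ^ 'm. x $ k = 0}"
      by (auto simp: convex_def)
    then show "convex D"
      unfolding D_def by (intro convex_Int convex_cball)
    have "0 \<in> D" by (simp add: D_def)
    then show "D \<noteq> {}" by blast
    have "continuous_on D lift"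
      unfolding lift_def by (intro continuous_intros)
    moreover have "continuous_on (lift ` D) h"
      using cont lift_in by (blast intro: continuous_on_subset)
    moreover have "continuous_on A proj" for A
      unfolding proj_def by (intro continuous_intros)
    ultimately show "continuous_on D (proj \<circ> h \<circ> lift)"
      by (intro continuous_on_compose)
    show "proj \<circ> h \<circ> lift \<in> D \<rightarrow> D"
      using lift_in proj_in maps by fastforce
  qed auto
  show thesis
  proof
    show "lift x \<in> hemisphere k" by (rule lift_in) fact
    \<comment> \<open>Both \<open>h (lift x)\<close> and \<open>lift x\<close> are in the hemisphere
      and project to \<open>x\<close>, and \<open>proj\<close> is injective there.\<close>
    then show "h (lift x) = lift x"
      using lift_proj[of "h (lift x)"] funcset_mem[OF maps] x(2) by metis
  qed
qed

lemma convex_half_space: "convex (half_space k)"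
  by (auto simp: convex_def half_space_def)

theorem theorem4p1:
  fixes n :: nat
    and k :: "'m::finite"
    and f :: "real ^ 'm \<Rightarrow> real ^ 'm"
  assumes "CARD('m) = n + 1"
    and "coarse_map (half_space k) (half_space k) f"
  shows "coarse_fixed_point_property (hemisphere k) f"
proof -
  have f_in: "f \<in> half_space k \<rightarrow> half_space k"
    and proper: "proper_map_on (half_space k) (half_space k) f"
    and born: "bornologous_on (half_space k) f"
    using assms(2) by (auto simp: coarse_map_def)
  \<comment> \<open>Bornology at scale 1 fixes \<open>S\<close> before any radius is chosen; it
    bounds the approximation error on every large hemisphere and is the final constant
    \<open>R\<close>.\<close>
  obtain S where "S > 0"
    and S: "\<And>x y. \<lbrakk>x \<in> half_space k; y \<in> half_space k; dist x y \<le> 1\<rbrakk> \<Longrightarrow> dist (f x) (f y) \<le> S"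
    using born unfolding bornologous_on_def by (metis zero_less_one)
  \<comment> \<open>Beyond radius \<open>r0\<close> the norm of \<open>f\<close> exceeds
    \<open>S\<close>, so no map within \<open>S\<close> of \<open>f\<close> can vanish
    there.\<close>
  have "bounded (f -` (cball 0 S \<inter> half_space k) \<inter> half_space k)"
    using proper unfolding proper_map_on_def by (meson Int_lower2 bounded_Int bounded_cball)
  then obtain r0 where "r0 > 0"
    and r0: "\<And>x. \<lbrakk>x \<in> half_space k; f x \<in> cball 0 S\<rbrakk> \<Longrightarrow> norm x \<le> r0"
    using f_in unfolding bounded_pos by blast
  have "\<exists>\<zeta>\<in>hemisphere k. infdist (f (r *\<^sub>R \<zeta>)) (ray \<zeta>) \<le> S" if "r > r0" for r
  proof -
    have in_half: "r *\<^sub>R \<zeta> \<in> half_space k" if "\<zeta> \<in> hemisphere k" for \<zeta>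
      using that \<open>r0 > 0\<close> \<open>r > r0\<close> by (simp add: half_space_def hemisphere_def)
    define K where "K = (*\<^sub>R) r ` hemisphere k"
    have "compact K"
      unfolding K_def by (intro compact_scaling compact_hemisphere)
    have K: "K \<subseteq> half_space k"
      using in_half by (auto simp: K_def)
    obtain g where g: "continuous_on K g" "g \<in> K \<rightarrow> half_space k"
      and close: "\<And>x. x \<in> K \<Longrightarrow> dist (f x) (g x) \<le> S"
    proof (rule continuous_approximation_on_compact[of K 1 "half_space k" f S])
      show "f \<in> K \<rightarrow> half_space k"
        using f_in K by auto
      show "dist (f x) (f y) \<le> S" if "x \<in> K" "y \<in> K" "dist x y < 1" for x y
        using S[of x y] that K by auto
    qed (use \<open>compact K\<close> convex_half_space in auto)
    have nonzero: "g (r *\<^sub>R \<zeta>) \<noteq> 0" if "\<zeta> \<in> hemisphere k" for \<zeta>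
    proof
      assume "g (r *\<^sub>R \<zeta>) = 0"
      then have "f (r *\<^sub>R \<zeta>) \<in> cball 0 S"
        using close[of "r *\<^sub>R \<zeta>"] that by (auto simp: K_def dist_commute)
      then have "norm (r *\<^sub>R \<zeta>) \<le> r0"
        using r0 in_half that by blast
      then show False
        using that \<open>r0 > 0\<close> \<open>r > r0\<close> by (simp add: hemisphere_def)
    qed
    \<comment> \<open>For vectors, \<open>sgn\<close> is radial projection to the unit sphere. It
      preserves the half-space, in which \<open>g\<close> takes its values.\<close>
    obtain \<zeta> where \<zeta>: "\<zeta> \<in> hemisphere k" "sgn (g (r *\<^sub>R \<zeta>)) = \<zeta>"
    proof (rule brouwer_hemisphere[of k "\<lambda>\<zeta>. sgn (g (r *\<^sub>R \<zeta>))"])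
      have "continuous_on (hemisphere k) (\<lambda>\<zeta>. g (r *\<^sub>R \<zeta>))"
        by (rule continuous_on_compose2[OF g(1)]) (auto simp: K_def intro!: continuous_intros)
      then show "continuous_on (hemisphere k) (\<lambda>\<zeta>. sgn (g (r *\<^sub>R \<zeta>)))"
        using nonzero by (intro continuous_on_sgn) auto
      show "(\<lambda>\<zeta>. sgn (g (r *\<^sub>R \<zeta>))) \<in> hemisphere k \<rightarrow> hemisphere k"
      proof
        fix \<zeta> assume \<zeta>: "\<zeta> \<in> hemisphere k"
        then have "g (r *\<^sub>R \<zeta>) \<in> half_space k"
          using g(2) by (auto simp: K_def)
        then show "sgn (g (r *\<^sub>R \<zeta>)) \<in> hemisphere k"
          using nonzero[OF \<zeta>]
          by (simp add: hemisphere_def half_space_def norm_sgn sgn_div_norm)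
      qed
    qed
    have "g (r *\<^sub>R \<zeta>) = norm (g (r *\<^sub>R \<zeta>)) *\<^sub>R \<zeta>"
      using nonzero[OF \<zeta>(1)] by (subst \<zeta>(2)[symmetric]) (simp add: sgn_div_norm)
    then have "g (r *\<^sub>R \<zeta>) \<in> ray \<zeta>"
      unfolding ray_def using norm_ge_zero by blast
    then have "infdist (f (r *\<^sub>R \<zeta>)) (ray \<zeta>) \<le> dist (f (r *\<^sub>R \<zeta>)) (g (r *\<^sub>R \<zeta>))"
      by (rule infdist_le)
    also have "\<dots> \<le> S"
      by (rule close) (use \<zeta>(1) in \<open>auto simp: K_def\<close>)
    finally show ?thesis
      using \<zeta>(1) by blast
  qed
  then obtain z where z: "\<And>r. r > r0 \<Longrightarrow> z r \<in> hemisphere k"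
    "\<And>r. r > r0 \<Longrightarrow> infdist (f (r *\<^sub>R z r)) (ray (z r)) \<le> S"
    by metis
  \<comment> \<open>The radii must all exceed \<open>r0\<close>, not just eventually, because the
    bounds are required for every index.\<close>
  define r where "r i = r0 + 1 + real i" for i
  define x where "x i = r i *\<^sub>R z (r i)" for i
  have r: "r i > r0" "r i > 0" for i
    using \<open>r0 > 0\<close> by (auto simp: r_def)
  have "norm (x i) = r i" for i
    using z(1)[OF r(1)] r(2)[of i] by (simp add: x_def hemisphere_def)
  moreover have "filterlim r at_top sequentially"
    unfolding r_def by (intro filterlim_tendsto_add_at_top[OF tendsto_const] filterlim_real_sequentially)
  ultimately have "filterlim (\<lambda>i. norm (x i)) at_top sequentially"
    by simp
  moreover have "x i \<in> open_cone (hemisphere k)" for i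
    using z(1)[OF r(1)] r(2)[of i] unfolding open_cone_def x_def by (blast intro: less_imp_le)
  moreover have "infdist (x i) (ray (z (r i))) \<le> S" for i
  proof -
    have "x i \<in> ray (z (r i))"
      using r(2)[of i] unfolding ray_def x_def by (blast intro: less_imp_le)
    then show ?thesis
      using \<open>S > 0\<close> by simp
  qed
  moreover have "infdist (f (x i)) (ray (z (r i))) \<le> S" for i
    using z(2)[OF r(1)] by (simp add: x_def)
  ultimately show ?thesis
    unfolding coarse_fixed_point_property_def using z(1)[OF r(1)] \<open>S > 0\<close>
    by (intro exI[of _ "\<lambda>i. z (r i)"] exI[of _ S] exI[of _ x]) auto
qed

end
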